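(* Let $d,n\in\mathbb{N}$ with $d\geq 2$ and $n\geq d+2$, let $P_{n,d}$ be the generalized path graph on $n$ vertices and let $C_{2n,d}$ be the generalized cycle graph on $2n$ vertices. Then $$a_1(P_{n,d})\leq a_1(C_{2n,d}).$$
   Context: For integers $m\ge d+1$, the generalized path graph $P_{m,d}$ is the simple undirected graph with vertex set $[m]=\{1,\dots,m\}$ and edge set $\{\{i,j\} : |i-j|\in\{1,\dots,d\}\}$, and the generalized cycle graph $C_{m,d}$ is the simple undirected graph with vertex set $[m]$ and edge set $\{\{i,j\} : |i-j|\in\{1,\dots,d,m-d,\dots,m-1\}\}$. For a graph $G$, $a_1(G)=\lambda_2(\mathbf{L}(G))$ is the algebraic connectivity: the second-smallest eigenvalue (counted with multiplicity) of the graph Laplacian $\mathbf{L}(G)$ (diagonal entries $\deg(i)$, off-diagonal entries $-1$ if $\{i,j\}\in E(G)$ and $0$ otherwise). *)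

theory Defs
  imports "Jordan_Normal_Form.Char_Poly"
begin

(* A simple undirected graph on the vertex set {1..m} is given by m and its set of edges,
   each edge being a two-element subset of {1..m}. *)
type_synonym edges = "nat set set"

definition gen_path :: "nat \<Rightarrow> nat \<Rightarrow> edges" where
  "gen_path m d = {{i, j} | i j. i \<in> {1..m} \<and> j \<in> {1..m} \<and>
     \<bar>int i - int j\<bar> \<in> {1..int d}}"

definition gen_cycle :: "nat \<Rightarrow> nat \<Rightarrow> edges" where
  "gen_cycle m d = {{i, j} | i j. i \<in> {1..m} \<and> j \<in> {1..m} \<and>
     \<bar>int i - int j\<bar> \<in> {1..int d} \<union> {int m - int d..int m - 1}}"

definition degree_of :: "edges \<Rightarrow> nat \<Rightarrow> nat" where
  "degree_of E v = card {e \<in> E. v \<in> e}"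

(* Matrix indices start at 0 and vertices at 1, so row and column i belong to vertex Suc i. *)
definition laplacian :: "nat \<Rightarrow> edges \<Rightarrow> real mat" where
  "laplacian m E = mat m m (\<lambda>(i, j).
     if i = j then real (degree_of E (Suc i))
     else if {Suc i, Suc j} \<in> E then -1 else 0)"

(* The eigenvalues in increasing order, each repeated according to its multiplicity as a root
   of the characteristic polynomial. For a symmetric real matrix of dimension m the list has
   length m, and this multiplicity is the dimension of the eigenspace. *)
definition eigenvalue_list :: "real mat \<Rightarrow> real list" where
  "eigenvalue_list A = sorted_list_of_multiset (proots (char_poly A))"

lemma set_eigenvalue_list:
  assumes "A \<in> carrier_mat m m"
  shows "set (eigenvalue_list A) = {x. eigenvalue A x}"
proof -
  have "char_poly A \<noteq> 0"
    using degree_monic_char_poly[OF assms] by auto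
  then show ?thesis
    using eigenvalue_root_char_poly[OF assms] by (simp add: eigenvalue_list_def)
qed

(* Meaningful for m \<ge> 2 only; list positions are counted from 0. *)
definition algebraic_connectivity :: "nat \<Rightarrow> edges \<Rightarrow> real" where
  "algebraic_connectivity m E = eigenvalue_list (laplacian m E) ! 1"

end

theory Submission
  imports Defs "HOL-Analysis.Function_Topology"
begin

text \<open>The cycle on \<open>2n\<close> vertices contains two disjoint copies of the path on \<open>n\<close> vertices: the reflection
\<open>i \<mapsto> 2n + 1 - i\<close> exchanges them, and the remaining edges of the cycle join one copy to the other. Let \<open>r\<close> be the algebraic connectivity of the cycle and \<open>x\<close> an eigenvector for \<open>r\<close>
with sum zero. If \<open>x\<close> is symmetric under the reflection, then its restriction \<open>y\<close> to one half has
sum zero, and deleting the edges between the halves shows that the Rayleigh quotient of \<open>y\<close> on the path is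
at most \<open>r\<close>; so the second eigenvalue of the path is at most \<open>r\<close>
(\<open>path_connectivity_le_symmetric_eigenvalue\<close>).

A symmetric eigenvector comes from symmetrising: the dihedral group acts on the eigenspace, so one may
add to \<open>x\<close>, or to \<open>x\<close> rotated by one step, its mirror image. Should both sums vanish, then \<open>x\<close> has period
\<open>2\<close> and is a multiple of the alternating vector (\<open>alternating_if_antisymmetric\<close>). In that case \<open>r\<close> can
be read off and is at least \<open>d\<close>, whereas the path always has algebraic connectivity at most \<open>d\<close>, as the
difference of the two end vertices shows. No explicit spectrum of the cycle enters.

What remains is the link between the sorted list of roots of the characteristic polynomial and Rayleigh
quotients (\<open>second_eigenvalue_variational\<close>). A minimiser of the Rayleigh quotient on the vectors with
sum zero exists by compactness and is an eigenvector; splitting off the all-ones vector from the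
characteristic polynomial shows that its eigenvalue is the second one, with multiplicities
respected.\<close>

section \<open>The Rayleigh quotient on vectors with sum zero\<close>

text \<open>Vectors of length \<open>n\<close> are functions on the natural numbers, so that \<open>n\<close> can stay a term. The
product topology on functions supplies the compactness: by Tychonoff, a product of intervals and
singletons is compact.\<close>
lemma compact_functions_supported_below:
  "compact {x :: nat \<Rightarrow> real. \<forall>i. x i \<in> (if i < n then {-1..1} else {0})}"
proof -
  let ?S = "\<lambda>i. if i < n then {-1..1} else {0::real}"
  have "compactin (product_topology (\<lambda>i. euclidean) UNIV) (PiE UNIV ?S)"
    by (subst compactin_PiE) auto
  moreover have "PiE UNIV ?S = {x :: nat \<Rightarrow> real. \<forall>i. x i \<in> ?S i}"
    by (simp add: PiE_UNIV_domain Pi_def)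
  ultimately show ?thesis
    by (simp add: euclidean_product_topology)
qed

lemma quadratic_nonneg_linear_zero:
  fixes a b :: real
  assumes "\<And>t. 0 \<le> 2 * t * a + t^2 * b" and "0 \<le> b"
  shows "a = 0"
proof (rule ccontr)
  assume "a \<noteq> 0"
  \<comment> \<open>The optimal \<open>t = - a / b\<close> is perturbed to avoid the division by zero for \<open>b = 0\<close>.\<close>
  define c where "c = 1 / (b + 1)"
  have c: "0 < c" "c * b = 1 - c"
    using assms(2) by (simp_all add: c_def field_simps)
  have "0 \<le> 2 * (- a * c) * a + (- a * c)^2 * b"
    by (rule assms)
  also have "\<dots> = a^2 * c * (c * b) - 2 * (a^2 * c)"
    by (simp add: power2_eq_square)
  also have "\<dots> = - (a^2 * c * (1 + c))"
    unfolding c(2) by (simp add: algebra_simps)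
  also have "\<dots> < 0"
    using c(1) \<open>a \<noteq> 0\<close> by simp
  finally show False by simp
qed

text \<open>The existence of an eigenvector, by compactness instead of a diagonalisation. The quadratic form
attains its minimum on the unit sphere of \<open>1\<^sup>\<bottom>\<close>, the space of vectors with sum zero. At a minimiser
\<open>y\<close> with value \<open>\<mu>\<close>, the derivative in every direction of \<open>1\<^sup>\<bottom>\<close> vanishes. The residual \<open>a y - \<mu> y\<close> is
itself such a direction, because symmetry and zero row sums keep \<open>1\<^sup>\<bottom>\<close> invariant; hence the
residual is orthogonal to itself.\<close>
lemma rayleigh_minimiser:
  fixes a :: "nat \<Rightarrow> nat \<Rightarrow> real"
  assumes "2 \<le> n"
    and sym: "\<And>i j. i < n \<Longrightarrow> j < n \<Longrightarrow> a i j = a j i"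
    and row_sum: "\<And>i. i < n \<Longrightarrow> (\<Sum>j<n. a i j) = 0"
  obtains y \<mu> where "(\<Sum>i<n. y i) = 0" and "\<exists>i<n. y i \<noteq> 0"
    and "\<And>i. i < n \<Longrightarrow> (\<Sum>j<n. a i j * y j) = \<mu> * y i"
    and "\<And>z. (\<Sum>i<n. z i) = 0 \<Longrightarrow>
           \<mu> * (\<Sum>i<n. (z i)^2) \<le> (\<Sum>i<n. z i * (\<Sum>j<n. a i j * z j))"
proof -
  define Q :: "(nat \<Rightarrow> real) \<Rightarrow> real" where "Q = (\<lambda>x. \<Sum>i<n. x i * (\<Sum>j<n. a i j * x j))"
  define N :: "(nat \<Rightarrow> real) \<Rightarrow> real" where "N = (\<lambda>x. \<Sum>i<n. (x i)^2)"
  define K where "K = {x :: nat \<Rightarrow> real. \<forall>i. x i \<in> (if i < n then {-1..1} else {0})}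
    \<inter> {x. (\<Sum>i<n. x i) = 0 \<and> N x = 1}"
  have cont_app: "continuous_on UNIV (\<lambda>x :: nat \<Rightarrow> real. x i)" for i
    by (rule continuous_on_product_coordinates)
  have cont: "continuous_on UNIV Q" "continuous_on UNIV N"
    unfolding Q_def N_def by (intro continuous_intros cont_app)+
  have "closed {x. (\<Sum>i<n. x i) = (0::real) \<and> N x = 1}"
    by (intro closed_Collect_conj closed_Collect_eq cont continuous_intros cont_app)
  then have "compact K"
    unfolding K_def by (intro compact_Int_closed compact_functions_supported_below)
  moreover have "K \<noteq> {}"
  proof -
    let ?e = "\<lambda>i::nat. if i = 0 then 1 / sqrt 2 else if i = 1 then - (1 / sqrt 2) else 0"
    have split: "{..<n} = insert 0 (insert 1 {2..<n})"
      using \<open>2 \<le> n\<close> by auto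
    have "(\<Sum>i<n. ?e i) = 0" "N ?e = 1"
      by (simp_all add: N_def split power_divide)
    moreover have "?e i \<in> (if i < n then {-1..1} else {0})" for i
    proof -
      have "-1 \<le> 1 / sqrt 2"
        by (rule order_trans[of _ 0]) simp_all
      then show ?thesis using \<open>2 \<le> n\<close> by auto
    qed
    ultimately have "?e \<in> K"
      by (simp add: K_def)
    then show ?thesis by blast
  qed
  ultimately obtain y where y: "y \<in> K" and y_min: "\<And>x. x \<in> K \<Longrightarrow> Q y \<le> Q x"
    using continuous_attains_inf[of K Q] cont(1) by (meson continuous_on_subset subset_UNIV)
  define \<mu> where "\<mu> = Q y"
  have y0: "(\<Sum>i<n. y i) = 0" and y1: "N y = 1"
    using y by (auto simp: K_def)
  \<comment> \<open>Homogeneity extends the minimality of \<open>y\<close> from the sphere to all vectors with sum zero.\<close>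
  have Q_ge: "\<mu> * N z \<le> Q z" if z0: "(\<Sum>i<n. z i) = 0" for z
  proof (cases "N z = 0")
    case True
    then have "\<forall>i<n. z i = 0"
      by (auto simp: N_def sum_nonneg_eq_0_iff)
    then show ?thesis by (simp add: Q_def N_def)
  next
    case False
    have "0 \<le> N z" by (simp add: N_def sum_nonneg)
    then have pos: "0 < N z" using False by simp
    define u where "u = (\<lambda>i. if i < n then z i / sqrt (N z) else 0)"
    have Nu: "N u = 1"
      using pos by (simp add: N_def u_def power_divide flip: sum_divide_distrib)
    have le: "\<bar>u i\<bar> \<le> 1" if "i < n" for i
    proof -
      have "(u i)^2 \<le> N u"
        unfolding N_def using that by (intro member_le_sum) auto
      then show ?thesis by (simp add: Nu abs_square_le_1)
    qed
    have "u i \<in> (if i < n then {-1..1} else {0})" for i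
      using le[of i] by (cases "i < n") (auto simp: abs_le_iff, simp add: u_def)
    moreover have "(\<Sum>i<n. u i) = 0"
      using z0 by (simp add: u_def flip: sum_divide_distrib)
    ultimately have "u \<in> K" by (simp add: K_def Nu)
    then have "\<mu> \<le> Q u" unfolding \<mu>_def by (rule y_min)
    also have "Q u = Q z / N z"
      using pos by (simp add: Q_def u_def flip: sum_divide_distrib)
    finally show ?thesis using pos by (simp add: field_simps)
  qed
  \<comment> \<open>The residual serves as the direction of variation.\<close>
  define w where "w = (\<lambda>i. (\<Sum>j<n. a i j * y j) - \<mu> * y i)"
  have col: "(\<Sum>i<n. \<Sum>j<n. a i j * x j) = 0" for x
  proof -
    have "(\<Sum>i<n. \<Sum>j<n. a i j * x j) = (\<Sum>j<n. \<Sum>i<n. a j i * x j)"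
      by (subst sum.swap) (simp add: sym)
    also have "\<dots> = 0" by (simp add: row_sum flip: sum_distrib_right)
    finally show ?thesis .
  qed
  have w0: "(\<Sum>i<n. w i) = 0"
    by (simp add: w_def sum_subtractf col y0 flip: sum_distrib_left)
  have swap: "(\<Sum>i<n. y i * (\<Sum>j<n. a i j * w j)) = (\<Sum>i<n. w i * (\<Sum>j<n. a i j * y j))"
    unfolding sum_distrib_left by (subst sum.swap) (simp add: sym ac_simps)
  have "(\<Sum>i<n. w i * (\<Sum>j<n. a i j * y j)) - \<mu> * (\<Sum>i<n. w i * y i) = 0"
  proof (rule quadratic_nonneg_linear_zero)
    show "0 \<le> Q w - \<mu> * N w" using Q_ge[OF w0] by simp
    fix t :: real
    have "(\<Sum>i<n. y i + t * w i) = 0"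
      by (simp add: sum.distrib y0 w0 flip: sum_distrib_left)
    from Q_ge[OF this] have "0 \<le> Q (\<lambda>i. y i + t * w i) - \<mu> * N (\<lambda>i. y i + t * w i)"
      by simp
    also have "Q (\<lambda>i. y i + t * w i) =
        Q y + 2 * t * (\<Sum>i<n. w i * (\<Sum>j<n. a i j * y j)) + t^2 * Q w"
    proof -
      have "Q (\<lambda>i. y i + t * w i) = Q y + t * (\<Sum>i<n. y i * (\<Sum>j<n. a i j * w j))
          + t * (\<Sum>i<n. w i * (\<Sum>j<n. a i j * y j)) + t^2 * Q w"
        by (simp add: Q_def algebra_simps sum.distrib sum_distrib_left power2_eq_square)
      then show ?thesis by (simp add: swap)
    qed
    also have "N (\<lambda>i. y i + t * w i) = N y + 2 * t * (\<Sum>i<n. w i * y i) + t^2 * N w"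
      by (simp add: N_def power2_sum sum.distrib sum_distrib_left algebra_simps power_mult_distrib)
    finally show "0 \<le> 2 * t * ((\<Sum>i<n. w i * (\<Sum>j<n. a i j * y j)) - \<mu> * (\<Sum>i<n. w i * y i))
        + t^2 * (Q w - \<mu> * N w)"
      by (simp add: y1 \<mu>_def algebra_simps)
  qed
  moreover have "N w = (\<Sum>i<n. w i * ((\<Sum>j<n. a i j * y j) - \<mu> * y i))"
    by (simp add: N_def w_def power2_eq_square)
  ultimately have "N w = 0"
    by (simp add: right_diff_distrib sum_subtractf mult.left_commute[of _ \<mu>] flip: sum_distrib_left)
  then have w_zero: "w i = 0" if "i < n" for i
    using that by (auto simp: N_def sum_nonneg_eq_0_iff)
  have "\<exists>i<n. y i \<noteq> 0"
  proof (rule ccontr)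
    assume "\<not> ?thesis"
    then have "N y = 0" by (simp add: N_def)
    then show False using y1 by simp
  qed
  with y0 w_zero Q_ge show thesis
    by (intro that[of y \<mu>]) (auto simp: w_def Q_def N_def)
qed

section \<open>The second root of the characteristic polynomial\<close>

text \<open>Deflation: change to the basis in which the first unit vector is replaced by the all-ones vector.
The latter is in the kernel, so the first column becomes zero and the matrix block triangular.
The statement is about the characteristic polynomial, so it also settles the multiplicity of the
eigenvalue \<open>0\<close>.\<close>
lemma char_poly_row_sums_zero:
  fixes A :: "'a :: idom mat"
  assumes A: "A \<in> carrier_mat (Suc k) (Suc k)"
    and row_sum: "\<And>i. i < Suc k \<Longrightarrow> (\<Sum>j<Suc k. A $$ (i, j)) = 0"
  shows "char_poly A = [:0, 1:] * char_poly (mat k k (\<lambda>(i, j). A $$ (Suc i, Suc j) - A $$ (0, Suc j)))"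
proof -
  \<comment> \<open>\<open>S 1\<close> has the all-ones vector as its first column, and \<open>S (- 1)\<close> is its inverse.\<close>
  define S :: "'a \<Rightarrow> 'a mat" where
    "S c = mat (Suc k) (Suc k) (\<lambda>(i, j). if i = j then 1 else if j = 0 then c else 0)" for c
  define C where "C = mat k k (\<lambda>(i, j). A $$ (Suc i, Suc j) - A $$ (0, Suc j))"
  define R where "R = mat 1 k (\<lambda>(i, j). A $$ (0, Suc j))"
  define B where "B = four_block_mat (0\<^sub>m 1 1) R (0\<^sub>m k 1) C"
  have carrier [simp]: "S c \<in> carrier_mat (Suc k) (Suc k)" "C \<in> carrier_mat k k"
    "R \<in> carrier_mat 1 k" for c
    by (simp_all add: S_def C_def R_def)
  have B: "B \<in> carrier_mat (Suc k) (Suc k)"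
    using four_block_carrier_mat[of "0\<^sub>m 1 1" 1 1 C k k] by (simp add: B_def)
  have S_mult: "(S c * M) $$ (i, j) = M $$ (i, j) + (if i = 0 then 0 else c * M $$ (0, j))"
    if "M \<in> carrier_mat (Suc k) (Suc k)" "i < Suc k" "j < Suc k" for c M i j
  proof -
    have "(S c * M) $$ (i, j) = (\<Sum>l<Suc k. S c $$ (i, l) * M $$ (l, j))"
      using that by (simp add: scalar_prod_def S_def atLeast0LessThan del: sum.lessThan_Suc)
    also have "\<dots> = (\<Sum>l<Suc k. (if l = i then M $$ (l, j) else 0)
        + (if l = 0 then if i = 0 then 0 else c * M $$ (0, j) else 0))"
      using that by (intro sum.cong refl) (auto simp: S_def)
    also have "\<dots> = M $$ (i, j) + (if i = 0 then 0 else c * M $$ (0, j))"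
      using that by (simp add: sum.distrib del: sum.lessThan_Suc)
    finally show ?thesis .
  qed
  have S_inverse: "S c * S d = 1\<^sub>m (Suc k)" if "c + d = 0" for c d
  proof (rule eq_matI)
    fix i j assume "i < dim_row (1\<^sub>m (Suc k) :: 'a mat)" "j < dim_col (1\<^sub>m (Suc k) :: 'a mat)"
    then show "(S c * S d) $$ (i, j) = 1\<^sub>m (Suc k) $$ (i, j)"
      using that by (subst S_mult) (auto simp: S_def add.commute)
  qed (simp_all add: S_def)
  have "S 1 * B = A * S 1"
  proof (rule eq_matI)
    fix i j assume "i < dim_row (A * S 1)" "j < dim_col (A * S 1)"
    then have ij: "i < Suc k" "j < Suc k" using A by (auto simp: S_def)
    have "(A * S 1) $$ (i, j) = (\<Sum>l<Suc k. A $$ (i, l) * S 1 $$ (l, j))"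
      using ij A by (simp add: scalar_prod_def S_def atLeast0LessThan del: sum.lessThan_Suc)
    also have "\<dots> = (if j = 0 then \<Sum>l<Suc k. A $$ (i, l) else (\<Sum>l<Suc k. if l = j then A $$ (i, l) else 0))"
    proof (cases "j = 0")
      case True
      then show ?thesis
        using ij by (simp del: sum.lessThan_Suc) (intro sum.cong refl, simp add: S_def)
    next
      case False
      then show ?thesis
        using ij by (simp del: sum.lessThan_Suc sum.delta) (intro sum.cong refl, simp add: S_def)
    qed
    also have "\<dots> = (if j = 0 then 0 else A $$ (i, j))"
      using ij row_sum by (simp del: sum.lessThan_Suc)
    also have "\<dots> = B $$ (i, j) + (if i = 0 then 0 else 1 * B $$ (0, j))"
      using ij by (cases i; cases j) (simp_all add: B_def four_block_mat_def C_def R_def)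
    also have "\<dots> = (S 1 * B) $$ (i, j)"
      using S_mult[OF B ij] by simp
    finally show "(S 1 * B) $$ (i, j) = (A * S 1) $$ (i, j)" ..
  qed (use A B in \<open>auto simp: S_def\<close>)
  then have "S 1 * B * S (- 1) = A * (S 1 * S (- 1))"
    using A B by (simp add: assoc_mult_mat[of _ "Suc k" "Suc k" _ "Suc k" _ "Suc k"])
  then have "A = S 1 * B * S (- 1)"
    using A by (simp add: S_inverse)
  then have "similar_mat A B"
    using A B by (intro similar_matI[of _ _ "S 1" "S (- 1)" "Suc k"]) (auto simp: S_inverse)
  then have "char_poly A = char_poly B"
    by (rule char_poly_similar)
  also have "\<dots> = char_poly (0\<^sub>m 1 1) * char_poly C"
    unfolding B_def by (intro char_poly_four_block_zeros_col carrier) simp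
  also have "char_poly (0\<^sub>m 1 1 :: 'a mat) = [:0, 1:]"
    by (simp add: char_poly_defs det_single)
  finally show ?thesis by (simp add: C_def)
qed

text \<open>The deflated matrix acts on vectors modulo constants, normalised to vanish at index \<open>0\<close>. Every class
modulo constants has exactly one representative with sum zero, and symmetry makes the space of
those representatives invariant, so the two spaces carry the same operator.\<close>
lemma eigenvalue_deflated_iff:
  fixes A :: "real mat"
  assumes A: "A \<in> carrier_mat (Suc k) (Suc k)"
    and sym: "\<And>i j. i < Suc k \<Longrightarrow> j < Suc k \<Longrightarrow> A $$ (i, j) = A $$ (j, i)"
    and row_sum: "\<And>i. i < Suc k \<Longrightarrow> (\<Sum>j<Suc k. A $$ (i, j)) = 0"
  defines "B \<equiv> mat k k (\<lambda>(i, j). A $$ (Suc i, Suc j) - A $$ (0, Suc j))"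
  shows "eigenvalue B r \<longleftrightarrow>
    (\<exists>x. (\<Sum>i<Suc k. x i) = 0 \<and> (\<exists>i<Suc k. x i \<noteq> 0) \<and>
         (\<forall>i<Suc k. (\<Sum>j<Suc k. A $$ (i, j) * x j) = r * x i))"
proof
  assume "eigenvalue B r"
  then obtain v where v: "v \<in> carrier_vec k" "v \<noteq> 0\<^sub>v k" "B *\<^sub>v v = r \<cdot>\<^sub>v v"
    by (auto simp: eigenvalue_def eigenvector_def B_def)
  define u where "u = (\<lambda>i. if i = 0 then 0 else v $ (i - 1))"
  define s where "s = (\<Sum>j<Suc k. A $$ (0, j) * u j)"
  have Au: "(\<Sum>j<Suc k. A $$ (i, j) * u j) = r * u i + s" if "i < Suc k" for i
  proof (cases i)
    case 0
    then show ?thesis by (simp add: s_def u_def)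
  next
    case (Suc l)
    then have l: "l < k" using that by simp
    have "(B *\<^sub>v v) $ l = r * v $ l"
      using v l by simp
    moreover have "(B *\<^sub>v v) $ l = (\<Sum>j<k. (A $$ (i, Suc j) - A $$ (0, Suc j)) * v $ j)"
      using v(1) l Suc by (simp add: B_def scalar_prod_def atLeast0LessThan)
    ultimately show ?thesis
      by (simp add: s_def u_def sum.lessThan_Suc_shift Suc left_diff_distrib sum_subtractf del: sum.lessThan_Suc)
  qed
  \<comment> \<open>Summing the defect equation over all rows determines the constant defect \<open>s\<close>.\<close>
  define U where "U = (\<Sum>i<Suc k. u i)"
  define m where "m = U / real (Suc k)"
  have "(\<Sum>i<Suc k. \<Sum>j<Suc k. A $$ (i, j) * u j) = (\<Sum>j<Suc k. (\<Sum>i<Suc k. A $$ (j, i)) * u j)"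
    unfolding sum_distrib_right by (subst sum.swap) (intro sum.cong refl, simp add: sym)
  also have "\<dots> = 0"
    using row_sum by (simp del: sum.lessThan_Suc)
  also have "(\<Sum>i<Suc k. \<Sum>j<Suc k. A $$ (i, j) * u j) = r * U + real (Suc k) * s"
    by (simp add: Au sum.distrib U_def sum_distrib_left del: sum.lessThan_Suc)
  finally have s: "s = - r * m"
    by (simp add: m_def field_simps del: of_nat_Suc)
  \<comment> \<open>Subtracting the mean turns the eigenvector modulo constants into a genuine one.\<close>
  define x where "x = (\<lambda>i. u i - m)"
  have "(\<Sum>i<Suc k. x i) = 0"
    by (simp add: x_def sum_subtractf U_def[symmetric] m_def del: sum.lessThan_Suc of_nat_Suc)
  moreover have "(\<Sum>j<Suc k. A $$ (i, j) * x j) = r * x i" if "i < Suc k" for i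
    using Au[OF that] row_sum[OF that]
    by (simp add: x_def s right_diff_distrib sum_subtractf del: sum.lessThan_Suc flip: sum_distrib_right)
  moreover have "\<exists>i<Suc k. x i \<noteq> 0"
  proof (rule ccontr)
    assume "\<not> ?thesis"
    then have x0: "x i = 0" if "i < Suc k" for i using that by blast
    have "m = 0" using x0[of 0] by (simp add: x_def u_def)
    then have "v $ l = 0" if "l < k" for l
      using x0[of "Suc l"] that by (simp add: x_def u_def)
    then have "v = 0\<^sub>v k" using v(1) by auto
    then show False using v(2) by blast
  qed
  ultimately show "\<exists>x. (\<Sum>i<Suc k. x i) = 0 \<and> (\<exists>i<Suc k. x i \<noteq> 0) \<and>
         (\<forall>i<Suc k. (\<Sum>j<Suc k. A $$ (i, j) * x j) = r * x i)"
    by blast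
next
  assume "\<exists>x. (\<Sum>i<Suc k. x i) = 0 \<and> (\<exists>i<Suc k. x i \<noteq> 0) \<and>
         (\<forall>i<Suc k. (\<Sum>j<Suc k. A $$ (i, j) * x j) = r * x i)"
  then obtain x where x0: "(\<Sum>i<Suc k. x i) = 0" and nz: "\<exists>i<Suc k. x i \<noteq> 0"
    and ev: "\<And>i. i < Suc k \<Longrightarrow> (\<Sum>j<Suc k. A $$ (i, j) * x j) = r * x i"
    by blast
  define v where "v = vec k (\<lambda>i. x (Suc i) - x 0)"
  have "v \<noteq> 0\<^sub>v k"
  proof
    assume "v = 0\<^sub>v k"
    then have "x (Suc l) = x 0" if "l < k" for l
      using that by (metis v_def index_vec index_zero_vec(1) eq_iff_diff_eq_0)
    then have const: "x i = x 0" if "i < Suc k" for i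
      using that by (cases i) auto
    have "(\<Sum>i<Suc k. x i) = (\<Sum>i<Suc k. x 0)"
      by (intro sum.cong refl const) simp
    then have "real (Suc k) * x 0 = 0"
      using x0 by (simp del: sum.lessThan_Suc of_nat_Suc)
    then have "x 0 = 0" by (simp del: of_nat_Suc)
    then show False using nz const by metis
  qed
  moreover have "B *\<^sub>v v = r \<cdot>\<^sub>v v"
  proof (rule eq_vecI)
    fix l assume "l < dim_vec (r \<cdot>\<^sub>v v)"
    then have l: "l < k" by (simp add: v_def)
    have shifted: "(\<Sum>j<k. A $$ (i, Suc j) * (x (Suc j) - x 0)) = r * x i" if "i < Suc k" for i
    proof -
      have "(\<Sum>j<k. A $$ (i, Suc j) * (x (Suc j) - x 0)) = (\<Sum>j<Suc k. A $$ (i, j) * (x j - x 0))"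
        by (subst sum.lessThan_Suc_shift) simp
      also have "\<dots> = r * x i"
        using ev[OF that] row_sum[OF that]
        by (simp add: right_diff_distrib sum_subtractf del: sum.lessThan_Suc flip: sum_distrib_right)
      finally show ?thesis .
    qed
    have "(B *\<^sub>v v) $ l = (\<Sum>j<k. (A $$ (Suc l, Suc j) - A $$ (0, Suc j)) * (x (Suc j) - x 0))"
      using l by (simp add: B_def v_def scalar_prod_def atLeast0LessThan)
    also have "\<dots> = r * (x (Suc l) - x 0)"
    proof -
      have "(\<Sum>j<k. (A $$ (Suc l, Suc j) - A $$ (0, Suc j)) * (x (Suc j) - x 0)) =
          (\<Sum>j<k. A $$ (Suc l, Suc j) * (x (Suc j) - x 0)) - (\<Sum>j<k. A $$ (0, Suc j) * (x (Suc j) - x 0))"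
        by (simp only: left_diff_distrib sum_subtractf)
      then show ?thesis
        using shifted[of "Suc l"] shifted[of 0] l by (simp only: right_diff_distrib[of r])
    qed
    finally show "(B *\<^sub>v v) $ l = (r \<cdot>\<^sub>v v) $ l"
      using l by (simp add: v_def)
  qed (simp add: B_def v_def)
  ultimately show "eigenvalue B r"
    unfolding eigenvalue_def eigenvector_def by (intro exI[of _ v]) (simp add: B_def v_def)
qed

text \<open>The Courant--Fischer principle for the second eigenvalue. By deflation the sorted spectrum is \<open>0\<close>
together with the eigenvalues on the vectors with sum zero; these are nonnegative, so \<open>0\<close> may be
placed first, and the entry at position \<open>1\<close> is their least element. The Rayleigh minimum is an
eigenvalue, and no eigenvalue lies below it, so it is this least element. A multiple eigenvalue
\<open>0\<close> is covered by the same count.\<close>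
lemma second_eigenvalue_variational:
  fixes A :: "real mat"
  assumes A: "A \<in> carrier_mat n n" and "2 \<le> n"
    and sym: "\<And>i j. i < n \<Longrightarrow> j < n \<Longrightarrow> A $$ (i, j) = A $$ (j, i)"
    and row_sum: "\<And>i. i < n \<Longrightarrow> (\<Sum>j<n. A $$ (i, j)) = 0"
    and psd: "\<And>x. 0 \<le> (\<Sum>i<n. x i * (\<Sum>j<n. A $$ (i, j) * x j))"
  defines "\<mu> \<equiv> eigenvalue_list A ! 1"
  shows second_eigenvector: "\<exists>x. (\<Sum>i<n. x i) = 0 \<and> (\<exists>i<n. x i \<noteq> 0) \<and>
          (\<forall>i<n. (\<Sum>j<n. A $$ (i, j) * x j) = \<mu> * x i)"
    and second_eigenvalue_le_rayleigh: "\<And>z. (\<Sum>i<n. z i) = 0 \<Longrightarrow>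
          \<mu> * (\<Sum>i<n. (z i)^2) \<le> (\<Sum>i<n. z i * (\<Sum>j<n. A $$ (i, j) * z j))"
proof -
  obtain y \<nu> where y0: "(\<Sum>i<n. y i) = 0" and y_nz: "\<exists>i<n. y i \<noteq> 0"
    and y_ev: "\<And>i. i < n \<Longrightarrow> (\<Sum>j<n. A $$ (i, j) * y j) = \<nu> * y i"
    and min: "\<And>z. (\<Sum>i<n. z i) = 0 \<Longrightarrow>
           \<nu> * (\<Sum>i<n. (z i)^2) \<le> (\<Sum>i<n. z i * (\<Sum>j<n. A $$ (i, j) * z j))"
    by (rule rayleigh_minimiser[of n "\<lambda>i j. A $$ (i, j)", OF \<open>2 \<le> n\<close> sym row_sum])
      (assumption | rule that)+
  obtain k where n: "n = Suc k" using \<open>2 \<le> n\<close> by (cases n) auto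
  define B where "B = mat k k (\<lambda>(i, j). A $$ (Suc i, Suc j) - A $$ (0, Suc j))"
  have B: "B \<in> carrier_mat k k" by (simp add: B_def)
  have B_ev: "eigenvalue B r \<longleftrightarrow>
    (\<exists>x. (\<Sum>i<n. x i) = 0 \<and> (\<exists>i<n. x i \<noteq> 0) \<and>
         (\<forall>i<n. (\<Sum>j<n. A $$ (i, j) * x j) = r * x i))" for r
    using eigenvalue_deflated_iff[of A k r] A sym row_sum unfolding n B_def by blast
  have pos: "0 < (\<Sum>i<n. (x i)^2)" if "\<exists>i<n. x i \<noteq> 0" for x :: "nat \<Rightarrow> real"
  proof -
    from that obtain i where "i < n" "x i \<noteq> 0" by blast
    then show ?thesis by (intro sum_pos2[of _ i]) auto
  qed
  have rayleigh: "(\<Sum>i<n. x i * (\<Sum>j<n. A $$ (i, j) * x j)) = r * (\<Sum>i<n. (x i)^2)"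
    if "\<forall>i<n. (\<Sum>j<n. A $$ (i, j) * x j) = r * x i" for x r
  proof -
    have "(\<Sum>i<n. x i * (\<Sum>j<n. A $$ (i, j) * x j)) = (\<Sum>i<n. x i * (r * x i))"
      using that by (intro sum.cong refl) simp
    then show ?thesis by (simp add: sum_distrib_left power2_eq_square ac_simps)
  qed
  have \<nu>: "eigenvalue B \<nu>"
    using B_ev y0 y_nz y_ev by blast
  have least: "\<nu> \<le> r" if ev: "eigenvalue B r" for r
  proof -
    obtain x where x: "(\<Sum>i<n. x i) = 0" "\<exists>i<n. x i \<noteq> 0"
      "\<forall>i<n. (\<Sum>j<n. A $$ (i, j) * x j) = r * x i"
      using ev B_ev by blast
    show ?thesis
      using min[OF x(1)] rayleigh[OF x(3)] pos[OF x(2)] by simp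
  qed
  have "0 \<le> \<nu>"
    using psd[of y] rayleigh[of y \<nu>] y_ev pos[OF y_nz] by (simp add: zero_le_mult_iff)
  have "char_poly B \<noteq> 0"
    using degree_monic_char_poly[OF B] by auto
  have "char_poly A = [:0, 1:] * char_poly B"
    using char_poly_row_sums_zero[of A k] A row_sum unfolding n B_def by blast
  then have "proots (char_poly A) = add_mset 0 (proots (char_poly B))"
    using \<open>char_poly B \<noteq> 0\<close> proots_mult[of "[:0, 1::real:]" "char_poly B"] by simp
  moreover define l where "l = eigenvalue_list B"
  have set_l: "set l = {r. eigenvalue B r}" and "sorted l"
    by (simp_all add: l_def set_eigenvalue_list[OF B]) (simp add: eigenvalue_list_def)
  ultimately have "eigenvalue_list A = insort 0 l"
    by (simp add: l_def eigenvalue_list_def)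
  also have "\<dots> = 0 # l"
    using set_l least \<open>0 \<le> \<nu>\<close> by (intro insort_is_Cons) fastforce
  finally have "\<mu> = l ! 0" by (simp add: \<mu>_def)
  moreover have "l \<noteq> []" using set_l \<nu> by auto
  moreover have "l ! 0 = \<nu>"
  proof (rule antisym)
    show "\<nu> \<le> l ! 0" using \<open>l \<noteq> []\<close> set_l least by (metis length_greater_0_conv mem_Collect_eq nth_mem)
    obtain i where "i < length l" "l ! i = \<nu>"
      using \<nu> set_l by (metis in_set_conv_nth mem_Collect_eq)
    then show "l ! 0 \<le> \<nu>" using sorted_nth_mono[OF \<open>sorted l\<close>, of 0 i] by simp
  qed
  ultimately have \<mu>: "\<mu> = \<nu>" by simp
  show "\<exists>x. (\<Sum>i<n. x i) = 0 \<and> (\<exists>i<n. x i \<noteq> 0) \<and>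
          (\<forall>i<n. (\<Sum>j<n. A $$ (i, j) * x j) = \<mu> * x i)"
    using y0 y_nz y_ev unfolding \<mu> by blast
  show "\<mu> * (\<Sum>i<n. (z i)^2) \<le> (\<Sum>i<n. z i * (\<Sum>j<n. A $$ (i, j) * z j))"
    if "(\<Sum>i<n. z i) = 0" for z
    using min[OF that] unfolding \<mu> .
qed

section \<open>Graph Laplacians and Dirichlet forms\<close>

text \<open>Indices start at \<open>0\<close> and vertices at \<open>1\<close>, as in the Laplacian matrix.\<close>
definition adj :: "edges \<Rightarrow> nat \<Rightarrow> nat \<Rightarrow> real" where
  "adj E i j = of_bool ({Suc i, Suc j} \<in> E)"

abbreviation lap :: "nat \<Rightarrow> edges \<Rightarrow> (nat \<Rightarrow> real) \<Rightarrow> nat \<Rightarrow> real" where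
  "lap m E x i \<equiv> \<Sum>j<m. adj E i j * (x i - x j)"

definition in_mean_zero_eigenspace :: "nat \<Rightarrow> edges \<Rightarrow> real \<Rightarrow> (nat \<Rightarrow> real) \<Rightarrow> bool" where
  "in_mean_zero_eigenspace m E r x \<longleftrightarrow> (\<Sum>i<m. x i) = 0 \<and> (\<forall>i<m. lap m E x i = r * x i)"

definition simple_edges :: "nat \<Rightarrow> edges \<Rightarrow> bool" where
  "simple_edges m E \<longleftrightarrow> E \<subseteq> {{i, j} | i j. i \<in> {1..m} \<and> j \<in> {1..m} \<and> i \<noteq> j}"

lemma adj_sym: "adj E i j = adj E j i"
  by (simp add: adj_def insert_commute)

lemma adj_nonneg: "0 \<le> adj E i j"
  by (simp add: adj_def)

lemma adj_refl:
  assumes "simple_edges m E"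
  shows "adj E i i = 0"
proof -
  have "{Suc i, Suc i} \<notin> E"
    using assms by (auto simp: simple_edges_def doubleton_eq_iff)
  then show ?thesis by (simp add: adj_def)
qed

lemma degree_of_eq_sum_adj:
  assumes "simple_edges m E"
  shows "real (degree_of E (Suc i)) = (\<Sum>j<m. adj E i j)"
proof -
  have inj: "inj_on (\<lambda>j. {Suc i, Suc j}) {j. j < m \<and> {Suc i, Suc j} \<in> E}"
    by (auto simp: inj_on_def doubleton_eq_iff)
  have "{e \<in> E. Suc i \<in> e} = (\<lambda>j. {Suc i, Suc j}) ` {j. j < m \<and> {Suc i, Suc j} \<in> E}"
  proof (intro equalityI subsetI)
    fix e assume e: "e \<in> {e \<in> E. Suc i \<in> e}"
    then obtain a b where ab: "e = {a, b}" "a \<in> {1..m}" "b \<in> {1..m}"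
      using assms by (auto simp: simple_edges_def)
    then obtain c where c: "e = {Suc i, c}" "c \<in> {1..m}"
      using e by (auto simp: insert_commute)
    then have "e = {Suc i, Suc (c - 1)}" "c - 1 < m"
      by auto
    then show "e \<in> (\<lambda>j. {Suc i, Suc j}) ` {j. j < m \<and> {Suc i, Suc j} \<in> E}"
      using e by blast
  qed auto
  then have "degree_of E (Suc i) = card {j. j < m \<and> {Suc i, Suc j} \<in> E}"
    by (simp add: degree_of_def card_image[OF inj])
  also have "{j. j < m \<and> {Suc i, Suc j} \<in> E} = {..<m} \<inter> {j. {Suc i, Suc j} \<in> E}"
    by auto
  finally show ?thesis
    by (simp add: adj_def sum_of_bool_eq)
qed

lemma laplacian_apply:
  assumes E: "simple_edges m E" and "i < m"
  shows "(\<Sum>j<m. laplacian m E $$ (i, j) * x j) = lap m E x i"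
proof -
  have "(\<Sum>j<m. laplacian m E $$ (i, j) * x j) =
      (\<Sum>j<m. (if j = i then real (degree_of E (Suc i)) * x i else 0) - adj E i j * x j)"
    using \<open>i < m\<close> adj_refl[OF E, of i]
    by (intro sum.cong refl) (auto simp: laplacian_def adj_def)
  also have "\<dots> = real (degree_of E (Suc i)) * x i - (\<Sum>j<m. adj E i j * x j)"
    using \<open>i < m\<close> by (simp add: sum_subtractf)
  also have "\<dots> = lap m E x i"
    by (simp add: degree_of_eq_sum_adj[OF E] right_diff_distrib sum_subtractf sum_distrib_right)
  finally show ?thesis .
qed

text \<open>Stated for arbitrary symmetric weights, because folding a cycle produces weights on pairs of indices
that are not the adjacency of a simple graph.\<close>
lemma dirichlet_form:
  fixes a :: "nat \<Rightarrow> nat \<Rightarrow> real"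
  assumes "\<And>i j. i < m \<Longrightarrow> j < m \<Longrightarrow> a i j = a j i"
  shows "(\<Sum>i<m. x i * (\<Sum>j<m. a i j * (x i - x j))) = (\<Sum>i<m. \<Sum>j<m. a i j * (x i - x j)^2) / 2"
proof -
  have "(\<Sum>i<m. x i * (\<Sum>j<m. a i j * (x i - x j))) = (\<Sum>i<m. \<Sum>j<m. x i * (a i j * (x i - x j)))" (is "?S = _")
    by (simp add: sum_distrib_left)
  moreover have "\<dots> = (\<Sum>i<m. \<Sum>j<m. x j * (a i j * (x j - x i)))"
    by (subst sum.swap) (simp add: assms)
  ultimately have "2 * ?S = (\<Sum>i<m. \<Sum>j<m. x i * (a i j * (x i - x j)) + x j * (a i j * (x j - x i)))"
    by (simp add: sum.distrib)
  also have "\<dots> = (\<Sum>i<m. \<Sum>j<m. a i j * (x i - x j)^2)"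
    by (intro sum.cong refl) (simp add: power2_eq_square algebra_simps)
  finally show ?thesis by simp
qed

lemma dirichlet_form_nonneg:
  fixes a :: "nat \<Rightarrow> nat \<Rightarrow> real"
  assumes "\<And>i j. i < m \<Longrightarrow> j < m \<Longrightarrow> a i j = a j i" and "\<And>i j. 0 \<le> a i j"
  shows "0 \<le> (\<Sum>i<m. x i * (\<Sum>j<m. a i j * (x i - x j)))"
  using assms(2) by (subst dirichlet_form[OF assms(1)]) (auto intro!: sum_nonneg)

lemma laplacian_variational:
  assumes E: "simple_edges m E" and m: "2 \<le> m"
  shows algebraic_connectivity_eigenvector:
      "\<exists>x. in_mean_zero_eigenspace m E (algebraic_connectivity m E) x \<and> (\<exists>i<m. x i \<noteq> 0)"
    and algebraic_connectivity_le_rayleigh: "(\<Sum>i<m. z i) = 0 \<Longrightarrow>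
      algebraic_connectivity m E * (\<Sum>i<m. (z i)^2) \<le> (\<Sum>i<m. z i * lap m E z i)"
proof -
  let ?L = "laplacian m E"
  have carrier: "?L \<in> carrier_mat m m"
    by (simp add: laplacian_def)
  have sym: "?L $$ (i, j) = ?L $$ (j, i)" if "i < m" "j < m" for i j
    using that by (auto simp: laplacian_def insert_commute)
  have row_sum: "(\<Sum>j<m. ?L $$ (i, j)) = 0" if "i < m" for i
    using laplacian_apply[OF E that, of "\<lambda>_. 1"] by simp
  have form: "(\<Sum>i<m. x i * (\<Sum>j<m. ?L $$ (i, j) * x j)) =
      (\<Sum>i<m. x i * lap m E x i)" for x
    by (intro sum.cong refl) (simp add: laplacian_apply[OF E])
  have psd: "0 \<le> (\<Sum>i<m. x i * (\<Sum>j<m. ?L $$ (i, j) * x j))" for x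
    unfolding form by (intro dirichlet_form_nonneg adj_sym adj_nonneg)
  note variational = carrier m sym row_sum psd
  obtain x where x: "(\<Sum>i<m. x i) = 0" "\<exists>i<m. x i \<noteq> 0"
      "\<forall>i<m. (\<Sum>j<m. ?L $$ (i, j) * x j) = algebraic_connectivity m E * x i"
    using second_eigenvector[OF variational] unfolding algebraic_connectivity_def by blast
  have "lap m E x i = algebraic_connectivity m E * x i" if "i < m" for i
    using x(3) that laplacian_apply[OF E that] by metis
  with x show "\<exists>x. in_mean_zero_eigenspace m E (algebraic_connectivity m E) x \<and> (\<exists>i<m. x i \<noteq> 0)"
    unfolding in_mean_zero_eigenspace_def by blast
  show "algebraic_connectivity m E * (\<Sum>i<m. (z i)^2) \<le> (\<Sum>i<m. z i * lap m E z i)"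
    if "(\<Sum>i<m. z i) = 0"
    using second_eigenvalue_le_rayleigh[OF variational that]
    by (simp only: algebraic_connectivity_def form)
qed

section \<open>Generalized paths and cycles, and the symmetries of the cycle\<close>

lemma simple_gen_path: "simple_edges m (gen_path m d)"
  unfolding simple_edges_def gen_path_def by (fastforce simp: doubleton_eq_iff)

lemma simple_gen_cycle:
  assumes "d < m"
  shows "simple_edges m (gen_cycle m d)"
  using assms unfolding simple_edges_def gen_cycle_def by (fastforce simp: doubleton_eq_iff)

text \<open>Covers generalized paths and generalized cycles, which differ only in the set \<open>D\<close> of admissible
differences.\<close>
lemma doubleton_in_difference_graph_iff:
  assumes "i < m" "j < m"
  shows "{Suc i, Suc j} \<in> {{a, b} | a b. a \<in> {1..m} \<and> b \<in> {1..m} \<and> \<bar>int a - int b\<bar> \<in> D}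
    \<longleftrightarrow> \<bar>int i - int j\<bar> \<in> D" (is "_ \<in> ?E \<longleftrightarrow> _")
proof
  assume "{Suc i, Suc j} \<in> ?E"
  then obtain a b where "{Suc i, Suc j} = {a, b}" and *: "\<bar>int a - int b\<bar> \<in> D"
    by blast
  then consider "a = Suc i" "b = Suc j" | "a = Suc j" "b = Suc i"
    by (auto simp: doubleton_eq_iff)
  then have "\<bar>int i - int j\<bar> = \<bar>int a - int b\<bar>" by cases auto
  then show "\<bar>int i - int j\<bar> \<in> D" using * by simp
next
  assume *: "\<bar>int i - int j\<bar> \<in> D"
  have "\<bar>int (Suc i) - int (Suc j)\<bar> = \<bar>int i - int j\<bar>" by simp
  moreover have "Suc i \<in> {1..m}" "Suc j \<in> {1..m}" using assms by auto
  ultimately show "{Suc i, Suc j} \<in> ?E"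
    using * by (intro CollectI exI[of _ "Suc i"] exI[of _ "Suc j"]) simp
qed

lemma adj_gen_path:
  assumes "i < m" "j < m"
  shows "adj (gen_path m d) i j = of_bool (\<bar>int i - int j\<bar> \<in> {1..int d})"
  unfolding adj_def gen_path_def doubleton_in_difference_graph_iff[OF assms] ..

lemma adj_gen_cycle:
  assumes "i < m" "j < m"
  shows "adj (gen_cycle m d) i j =
    of_bool (\<bar>int i - int j\<bar> \<in> {1..int d} \<union> {int m - int d..int m - 1})"
  unfolding adj_def gen_cycle_def doubleton_in_difference_graph_iff[OF assms] ..

text \<open>Graph automorphisms commute with the Laplacian.\<close>
lemma mean_zero_eigenspace_automorphism:
  assumes x: "in_mean_zero_eigenspace m E r x"
    and bij: "bij_betw \<pi> {..<m} {..<m}"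
    and aut: "\<And>i j. i < m \<Longrightarrow> j < m \<Longrightarrow> adj E (\<pi> i) (\<pi> j) = adj E i j"
  shows "in_mean_zero_eigenspace m E r (x \<circ> \<pi>)"
proof -
  have "(\<Sum>i<m. x (\<pi> i)) = 0"
    using sum.reindex_bij_betw[OF bij, of x] x by (simp add: in_mean_zero_eigenspace_def)
  moreover have "lap m E (x \<circ> \<pi>) i = r * x (\<pi> i)" if "i < m" for i
  proof -
    have "\<pi> i < m" using bij that by (auto dest: bij_betwE)
    have "lap m E (x \<circ> \<pi>) i = (\<Sum>j<m. adj E (\<pi> i) (\<pi> j) * (x (\<pi> i) - x (\<pi> j)))"
      using that by (intro sum.cong refl) (simp add: aut)
    also have "\<dots> = lap m E x (\<pi> i)"
      by (rule sum.reindex_bij_betw[OF bij])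
    finally show ?thesis
      using x \<open>\<pi> i < m\<close> by (simp add: in_mean_zero_eigenspace_def)
  qed
  ultimately show ?thesis by (simp add: in_mean_zero_eigenspace_def)
qed

lemma mean_zero_eigenspace_add:
  assumes "in_mean_zero_eigenspace m E r x" "in_mean_zero_eigenspace m E r y"
  shows "in_mean_zero_eigenspace m E r (\<lambda>i. x i + y i)"
proof -
  have "lap m E (\<lambda>i. x i + y i) i = lap m E x i + lap m E y i" for i
    by (simp add: sum.distrib[symmetric] algebra_simps)
  then show ?thesis
    using assms by (simp add: in_mean_zero_eigenspace_def sum.distrib distrib_left)
qed

lemma gen_cycle_reflection:
  "bij_betw (\<lambda>i. m - 1 - i) {..<m} {..<m}"
  "i < m \<Longrightarrow> j < m \<Longrightarrow>
     adj (gen_cycle m d) (m - 1 - i) (m - 1 - j) = adj (gen_cycle m d) i j"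
proof -
  show "bij_betw (\<lambda>i. m - 1 - i) {..<m} {..<m}"
    by (rule bij_betw_byWitness[where f' = "\<lambda>i. m - 1 - i"]) auto
  show "adj (gen_cycle m d) (m - 1 - i) (m - 1 - j) = adj (gen_cycle m d) i j"
    if "i < m" "j < m"
  proof -
    have "\<bar>int (m - 1 - i) - int (m - 1 - j)\<bar> = \<bar>int i - int j\<bar>"
      using that by (simp add: of_nat_diff)
    then show ?thesis using that by (simp add: adj_gen_cycle)
  qed
qed

definition rotation :: "nat \<Rightarrow> nat \<Rightarrow> nat" where
  "rotation m i = (if Suc i = m then 0 else Suc i)"

lemma gen_cycle_rotation:
  "bij_betw (rotation m) {..<m} {..<m}"
  "i < m \<Longrightarrow> j < m \<Longrightarrow>
     adj (gen_cycle m d) (rotation m i) (rotation m j) = adj (gen_cycle m d) i j"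
proof -
  show "bij_betw (rotation m) {..<m} {..<m}"
    by (rule bij_betw_byWitness[where f' = "\<lambda>i. if i = 0 then m - 1 else i - 1"]) (auto simp: rotation_def)
  show "adj (gen_cycle m d) (rotation m i) (rotation m j) = adj (gen_cycle m d) i j" if "i < m" "j < m"
  proof -
    let ?D = "{1..int d} \<union> {int m - int d..int m - 1}"
    have lt: "rotation m i < m" "rotation m j < m" using that by (auto simp: rotation_def)
    \<comment> \<open>Wrapping around replaces a difference \<open>t\<close> by \<open>m - t\<close>.\<close>
    have D: "int m - t \<in> ?D \<longleftrightarrow> t \<in> ?D" for t
      by auto
    have "\<bar>int (rotation m i) - int (rotation m j)\<bar> = \<bar>int i - int j\<bar> \<or>
        \<bar>int (rotation m i) - int (rotation m j)\<bar> = int m - \<bar>int i - int j\<bar>"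
      using that by (auto simp: rotation_def)
    then have "\<bar>int (rotation m i) - int (rotation m j)\<bar> \<in> ?D \<longleftrightarrow> \<bar>int i - int j\<bar> \<in> ?D"
      using D by metis
    then show ?thesis
      by (simp only: adj_gen_cycle[OF lt] adj_gen_cycle[OF that])
  qed
qed

section \<open>Folding the cycle onto the path\<close>

lemma sum_fold_halves:
  fixes f :: "nat \<Rightarrow> real"
  shows "(\<Sum>j<2*n. f j) = (\<Sum>j<n. f j) + (\<Sum>j<n. f (2*n - 1 - j))"
proof -
  have "{..<2*n} = {..<n} \<union> {n..<2*n}" by auto
  moreover have "sum f ({..<n} \<union> {n..<2*n}) = (\<Sum>j<n. f j) + (\<Sum>j\<in>{n..<2*n}. f j)"
    by (rule sum.union_disjoint) auto
  ultimately have "(\<Sum>j<2*n. f j) = (\<Sum>j<n. f j) + (\<Sum>j\<in>{n..<2*n}. f j)"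
    by simp
  also have "(\<Sum>j\<in>{n..<2*n}. f j) = (\<Sum>j<n. f (2*n - 1 - j))"
    by (rule sum.reindex_bij_witness[of _ "\<lambda>j. 2*n - 1 - j" "\<lambda>j. 2*n - 1 - j"]) auto
  finally show ?thesis .
qed

text \<open>The folding argument. Identifying the mirror images \<open>i\<close> and \<open>2n - 1 - i\<close> turns the cycle into the path
plus extra nonnegative symmetric weights \<open>b\<close>, which come from the edges between the two halves. For a
symmetric \<open>y\<close>, half of the eigenvalue equation is an eigenvalue equation for this heavier graph, with
the same eigenvalue \<open>r\<close>. Dropping \<open>b\<close> only lowers the Dirichlet form, so the Rayleigh quotient of \<open>y\<close> on
the path is at most \<open>r\<close>.\<close>
lemma path_connectivity_le_symmetric_eigenvalue:
  assumes "2 \<le> n" "d \<le> n"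
    and y: "in_mean_zero_eigenspace (2*n) (gen_cycle (2*n) d) r y"
    and symmetric: "\<And>i. i < 2*n \<Longrightarrow> y (2*n - 1 - i) = y i"
    and nz: "\<exists>i<2*n. y i \<noteq> 0"
  shows "algebraic_connectivity n (gen_path n d) \<le> r"
proof -
  let ?c = "adj (gen_cycle (2*n) d)" and ?p = "adj (gen_path n d)"
  let ?b = "\<lambda>i j. ?c i (2*n - 1 - j)"
  have mirror: "y (2*n - Suc i) = y i" if "i < n" for i
    using symmetric[of i] that by simp
  have "(\<Sum>i<2*n. y i) = 2 * (\<Sum>i<n. y i)"
    unfolding sum_fold_halves by (simp add: mirror)
  then have y0: "(\<Sum>i<n. y i) = 0"
    using y by (simp add: in_mean_zero_eigenspace_def)
  have cp: "?c i j = ?p i j" if "i < n" "j < n" for i j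
    using that \<open>d \<le> n\<close> by (auto simp: adj_gen_cycle adj_gen_path)
  have folded: "lap n (gen_path n d) y i + (\<Sum>j<n. ?b i j * (y i - y j)) = r * y i" if "i < n" for i
  proof -
    have "r * y i = lap (2*n) (gen_cycle (2*n) d) y i"
      using y that by (simp add: in_mean_zero_eigenspace_def)
    also have "\<dots> = lap n (gen_path n d) y i + (\<Sum>j<n. ?b i j * (y i - y j))"
      unfolding sum_fold_halves using that by (simp add: mirror cp)
    finally show ?thesis ..
  qed
  have b_sym: "?b i j = ?b j i" if "i < n" "j < n" for i j
  proof -
    have "\<bar>int i - int (2*n - 1 - j)\<bar> = \<bar>int j - int (2*n - 1 - i)\<bar>"
      using that by (simp add: of_nat_diff)
    then show ?thesis using that by (simp add: adj_gen_cycle)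
  qed
  have "algebraic_connectivity n (gen_path n d) * (\<Sum>i<n. (y i)^2)
      \<le> (\<Sum>i<n. y i * lap n (gen_path n d) y i)"
    by (rule algebraic_connectivity_le_rayleigh[OF simple_gen_path \<open>2 \<le> n\<close> y0])
  also have "\<dots> \<le> (\<Sum>i<n. y i * lap n (gen_path n d) y i)
      + (\<Sum>i<n. y i * (\<Sum>j<n. ?b i j * (y i - y j)))"
    using dirichlet_form_nonneg[of n ?b y] b_sym by (simp add: adj_nonneg)
  also have "\<dots> = (\<Sum>i<n. y i * (lap n (gen_path n d) y i + (\<Sum>j<n. ?b i j * (y i - y j))))"
    by (simp add: sum.distrib distrib_left)
  also have "\<dots> = (\<Sum>i<n. y i * (r * y i))"
    using folded by (intro sum.cong refl) (simp only: lessThan_iff)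
  also have "\<dots> = r * (\<Sum>i<n. (y i)^2)"
    by (simp add: sum_distrib_left power2_eq_square ac_simps)
  finally have le: "algebraic_connectivity n (gen_path n d) * (\<Sum>i<n. (y i)^2) \<le> r * (\<Sum>i<n. (y i)^2)" .
  from nz obtain i where i: "i < 2*n" "y i \<noteq> 0" by blast
  then have "\<exists>i<n. y i \<noteq> 0"
  proof (cases "i < n")
    case False
    then show ?thesis using i symmetric[of i] by (intro exI[of _ "2*n - 1 - i"]) auto
  qed auto
  then have "0 < (\<Sum>i<n. (y i)^2)"
    by (auto intro: sum_pos2)
  with le show ?thesis by simp
qed

text \<open>The test vector is \<open>1\<close> and \<open>-1\<close> at the two ends. They have degree \<open>d\<close> each and are not adjacent, since their
distance is \<open>n - 1 > d\<close>.\<close>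
lemma path_connectivity_le:
  assumes "d + 2 \<le> n"
  shows "algebraic_connectivity n (gen_path n d) \<le> real d"
proof -
  define z :: "nat \<Rightarrow> real" where "z = (\<lambda>i. if i = 0 then 1 else if i = n - 1 then -1 else 0)"
  let ?p = "adj (gen_path n d)"
  have ends: "(\<Sum>i<n. f i) = f 0 + f (n - 1)"
    if "\<And>i. i \<noteq> 0 \<Longrightarrow> i \<noteq> n - 1 \<Longrightarrow> f i = 0" for f :: "nat \<Rightarrow> real"
  proof -
    have "(\<Sum>i<n. f i) = (\<Sum>i\<in>{0, n - 1}. f i)"
      using that assms by (intro sum.mono_neutral_right) auto
    then show ?thesis using assms by simp
  qed
  have z0: "(\<Sum>i<n. z i) = 0" and z2: "(\<Sum>i<n. (z i)^2) = 2"
    using assms by (subst ends; simp add: z_def)+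
  have first: "lap n (gen_path n d) z 0 = real d"
  proof -
    have "lap n (gen_path n d) z 0 = (\<Sum>j<n. of_bool (j \<in> {1..d}))"
      using assms by (intro sum.cong refl) (auto simp: adj_gen_path z_def)
    also have "\<dots> = real (card ({..<n} \<inter> {1..d}))"
      by (simp add: sum_of_bool_eq Int_def)
    also have "{..<n} \<inter> {1..d} = {1..d}" using assms by auto
    finally show ?thesis by simp
  qed
  have last: "lap n (gen_path n d) z (n - 1) = - real d"
  proof -
    have "lap n (gen_path n d) z (n - 1) = (\<Sum>j<n. - of_bool (j \<in> {n - 1 - d..<n - 1}))"
      using assms by (intro sum.cong refl) (auto simp: adj_gen_path z_def)
    also have "\<dots> = - real (card ({..<n} \<inter> {n - 1 - d..<n - 1}))"
      by (simp add: sum_of_bool_eq Int_def sum_negf)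
    also have "{..<n} \<inter> {n - 1 - d..<n - 1} = {n - 1 - d..<n - 1}" by auto
    finally show ?thesis using assms by simp
  qed
  have "(\<Sum>i<n. z i * lap n (gen_path n d) z i) = 2 * real d"
  proof -
    have "(\<Sum>i<n. z i * lap n (gen_path n d) z i) =
        z 0 * lap n (gen_path n d) z 0 + z (n - 1) * lap n (gen_path n d) z (n - 1)"
      by (rule ends) (simp add: z_def)
    also have "\<dots> = 2 * real d"
      unfolding first last using assms by (simp add: z_def)
    finally show ?thesis .
  qed
  then show ?thesis
    using algebraic_connectivity_le_rayleigh[OF simple_gen_path _ z0, of d] assms by (simp add: z2)
qed

text \<open>The eigenvalue equation at index \<open>0\<close> expresses \<open>r\<close> as twice the number of neighbours with odd index.
The neighbours \<open>1, \<dots>, d\<close> alone contribute \<open>d\<close> or \<open>d + 1\<close>.\<close>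
lemma alternating_eigenvalue_ge:
  assumes "d < m"
    and x: "in_mean_zero_eigenspace m (gen_cycle m d) r x"
    and alternating: "\<And>i. i < m \<Longrightarrow> x i = (-1) ^ i * x 0"
    and nz: "\<exists>i<m. x i \<noteq> 0"
  shows "real d \<le> r"
proof -
  have "x 0 \<noteq> 0" using nz alternating by (metis mult_zero_right)
  have odd: "real k \<le> (\<Sum>j\<in>{1..k}. 1 - (-1) ^ j)" for k
  proof -
    have "(\<Sum>j\<in>{1..k}. 1 - (-1) ^ j :: real) = real k + of_bool (odd k)"
      by (induction k) auto
    then show ?thesis by simp
  qed
  have "lap m (gen_cycle m d) x 0 = (\<Sum>j<m. adj (gen_cycle m d) 0 j * (1 - (-1) ^ j)) * x 0"
    unfolding sum_distrib_right
    by (intro sum.cong refl) (subst alternating, auto simp: algebra_simps)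
  moreover have "lap m (gen_cycle m d) x 0 = r * x 0"
    using x \<open>d < m\<close> by (simp add: in_mean_zero_eigenspace_def)
  ultimately have r: "r = (\<Sum>j<m. adj (gen_cycle m d) 0 j * (1 - (-1) ^ j))"
    using \<open>x 0 \<noteq> 0\<close> by simp
  have "real d \<le> (\<Sum>j\<in>{1..d}. 1 - (-1) ^ j)" by (rule odd)
  also have "\<dots> = (\<Sum>j\<in>{1..d}. adj (gen_cycle m d) 0 j * (1 - (-1) ^ j))"
    using \<open>d < m\<close> by (intro sum.cong refl) (simp add: adj_gen_cycle)
  also have "\<dots> \<le> r"
    unfolding r using \<open>d < m\<close>
    by (intro sum_mono2) (auto intro!: mult_nonneg_nonneg simp: adj_nonneg minus_one_power_iff)
  finally show ?thesis .
qed

text \<open>Modulo \<open>m\<close>, the hypotheses are antisymmetry under the reflections \<open>i \<mapsto> - 1 - i\<close> and \<open>i \<mapsto> 1 - i\<close>.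
Their composition is a rotation by two steps, and the two signs cancel, so \<open>x i\<close> depends only on the
parity of \<open>i\<close>. The first reflection exchanges the parities because \<open>m\<close> is even.\<close>
lemma alternating_if_antisymmetric:
  fixes x :: "nat \<Rightarrow> real"
  assumes "2 \<le> m" "even m"
    and anti: "\<And>i. i < m \<Longrightarrow> x (m - 1 - i) = - x i"
    and anti_rotated: "\<And>i. 0 < i \<Longrightarrow> i < m - 1 \<Longrightarrow> x (m - i) = - x (Suc i)"
    and "i < m"
  shows "x i = (-1) ^ i * x 0"
proof -
  have step: "x (Suc (Suc k)) = x k" if "Suc (Suc k) < m" for k
    using anti_rotated[of "Suc k"] anti[of k] that by simp
  have parity: "k < m \<Longrightarrow> x k = x (k mod 2)" for k
  proof (induction k rule: less_induct)
    case (less k)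
    show ?case
    proof (cases "k < 2")
      case False
      then obtain l where "k = Suc (Suc l)"
        by (metis add_2_eq_Suc le_Suc_ex linorder_not_less)
      then show ?thesis using less.IH[of l] less.prems step[of l] by simp
    qed simp
  qed
  have "odd (m - 1)"
    using \<open>2 \<le> m\<close> \<open>even m\<close> by simp
  then have "x 1 = x ((m - 1) mod 2)"
    by (simp only: odd_iff_mod_2_eq_one)
  also have "\<dots> = x (m - 1)"
    by (rule parity[symmetric]) (use \<open>2 \<le> m\<close> in simp)
  also have "\<dots> = - x 0"
    using anti[of 0] \<open>2 \<le> m\<close> by simp
  finally have "x 1 = - x 0" .
  then show ?thesis
    using parity[OF \<open>i < m\<close>] by (cases "even i") (simp_all add: odd_iff_mod_2_eq_one)
qed

theorem proposition13:
  fixes d n :: nat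
  assumes "d \<ge> 2" and "n \<ge> d + 2"
  shows "algebraic_connectivity n (gen_path n d)
       \<le> algebraic_connectivity (2 * n) (gen_cycle (2 * n) d)"
proof -
  let ?C = "gen_cycle (2 * n) d"
  let ?r = "algebraic_connectivity (2 * n) ?C"
  have n: "2 \<le> n" "d \<le> n" "d < 2 * n" using assms by auto
  obtain x where x: "in_mean_zero_eigenspace (2 * n) ?C ?r x" and nz: "\<exists>i<2 * n. x i \<noteq> 0"
    using algebraic_connectivity_eigenvector[OF simple_gen_cycle[OF n(3)]] n by auto
  have symmetrisation: ?thesis
    if y: "in_mean_zero_eigenspace (2 * n) ?C ?r y" and y_nz: "\<exists>i<2 * n. y i + y (2 * n - 1 - i) \<noteq> 0" for y
  proof (rule path_connectivity_le_symmetric_eigenvalue[OF n(1,2)])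
    have "in_mean_zero_eigenspace (2 * n) ?C ?r (y \<circ> (\<lambda>i. 2 * n - 1 - i))"
      by (intro mean_zero_eigenspace_automorphism y gen_cycle_reflection)
    from mean_zero_eigenspace_add[OF y this]
    show "in_mean_zero_eigenspace (2 * n) ?C ?r (\<lambda>i. y i + y (2 * n - 1 - i))"
      by (simp only: o_apply)
    show "y (2 * n - 1 - i) + y (2 * n - 1 - (2 * n - 1 - i)) = y i + y (2 * n - 1 - i)"
      if "i < 2 * n" for i
      using that by simp
  qed (rule y_nz)
  have rotated: "in_mean_zero_eigenspace (2 * n) ?C ?r (x \<circ> rotation (2 * n))"
    by (intro mean_zero_eigenspace_automorphism x gen_cycle_rotation)
  show ?thesis
  proof (cases "(\<exists>i<2 * n. x i + x (2 * n - 1 - i) \<noteq> 0) \<or>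
      (\<exists>i<2 * n. (x \<circ> rotation (2 * n)) i + (x \<circ> rotation (2 * n)) (2 * n - 1 - i) \<noteq> 0)")
    case True
    then show ?thesis using symmetrisation[OF x] symmetrisation[OF rotated] by blast
  next
    case False
    \<comment> \<open>Neither symmetrisation survives, so \<open>x\<close> is the alternating vector.\<close>
    have "x i = (-1) ^ i * x 0" if "i < 2 * n" for i
    proof (rule alternating_if_antisymmetric[OF _ _ _ _ that])
      show "x (2 * n - 1 - i) = - x i" if "i < 2 * n" for i
      proof -
        have "x i + x (2 * n - 1 - i) = 0" using False that by blast
        then show ?thesis by linarith
      qed
      show "x (2 * n - i) = - x (Suc i)" if "0 < i" "i < 2 * n - 1" for i
      proof -
        have "(x \<circ> rotation (2 * n)) i + (x \<circ> rotation (2 * n)) (2 * n - 1 - i) = 0"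
          using False that by auto
        moreover have "rotation (2 * n) i = Suc i" "rotation (2 * n) (2 * n - 1 - i) = 2 * n - i"
          using that by (auto simp: rotation_def)
        ultimately show ?thesis by simp
      qed
    qed (use n in auto)
    then have "real d \<le> ?r"
      using alternating_eigenvalue_ge[OF n(3) x _ nz] by blast
    with path_connectivity_le[of d n] assms show ?thesis by simp
  qed
qed

end
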